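(* For every integer $r\ge1$, the characteristic polynomial of the linear recurrence sequence $(d_n^{(r)})_{n\ge r}$ is $$q^{(r)}(x)=(x^2-x-1)^{2r-1}.$$ That is, writing $q^{(r)}(x)=\sum_{j=0}^{4r-2}c_j x^{4r-2-j}$, one has $\sum_{j=0}^{4r-2}c_j\, d_{n-j}^{(r)}=0$ for all $n\ge r+(4r-2)$.
   Context: $F_m$ denotes the Fibonacci numbers: $F_0=0$, $F_1=1$, $F_m=F_{m-1}+F_{m-2}$ for $m\ge 2$. ${n\brace k}$ denotes the Stirling number of the second kind (the number of partitions of an $n$-element set into exactly $k$ non-empty blocks). The Fibonacci-Fubini triangle has entries $\mathcal{F}(n,k)=F_{k+1}{n\brace k}$ for $n\ge1$, $1\le k\le n$. For $r\ge1$ the $r$th right-down diagonal sequence $(d_n^{(r)})_{n=r}^\infty$ is defined by $d_n^{(r)}=\mathcal{F}(n,n-r+1)=F_{n-r+2}{n\brace n-r+1}$. *)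

theory Defs
  imports
    "HOL-Number_Theory.Fib"
    "HOL-Combinatorics.Stirling"
    "HOL-Computational_Algebra.Polynomial"
begin

(* Stirling n k is the library's Stirling number of the second kind
   (stirling, in lower case, is the first kind). *)
definition fib_fubini :: "nat \<Rightarrow> nat \<Rightarrow> nat" where
  "fib_fubini n k = fib (k + 1) * Stirling n k"

(* Only the values at n \<ge> r are meaningful; for n < r the subtraction truncates. *)
definition diag_seq :: "nat \<Rightarrow> nat \<Rightarrow> nat" where
  "diag_seq r n = fib_fubini n (n - r + 1)"

definition diag_poly :: "nat \<Rightarrow> int poly" where
  "diag_poly r = [:-1, -1, 1:] ^ (2 * r - 1)"

(* For q = c_0 x^k + c_1 x^(k-1) + ... + c_k monic of degree k, the sequence
   (a_n), n \<ge> s, satisfies c_0 a_n + c_1 a_(n-1) + ... + c_k a_(n-k) = 0 as soon as all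
   the indices are at least s.  No minimality of the recurrence is required. *)
definition is_char_poly_from :: "nat \<Rightarrow> (nat \<Rightarrow> 'a :: comm_ring_1) \<Rightarrow> 'a poly \<Rightarrow> bool" where
  "is_char_poly_from s a q \<longleftrightarrow>
     lead_coeff q = 1 \<and>
     (\<forall>n \<ge> s + degree q. (\<Sum>j=0..degree q. coeff q (degree q - j) * a (n - j)) = 0)"

end

theory Submission
  imports Defs
begin

text \<open>
  For fixed \<open>s\<close> the function \<open>k \<mapsto> S(k + s, k)\<close> is a polynomial of degree at most \<open>2 s\<close>: its
  forward difference is \<open>(k + 1) S(k + s, k + 1)\<close>, so passing from \<open>s - 1\<close> to \<open>s\<close> costs one degree
  for the linear factor and one for the summation. If \<open>G\<close> satisfies the Fibonacci recurrence,
  then the operator \<open>E\<^sup>2 - E - 1\<close> (with \<open>E\<close> the shift) turns \<open>p G\<close> into a sum of products of the same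
  kind whose polynomial factors are differences of \<open>p\<close>, hence of smaller degree. After \<open>2 r - 1\<close>
  applications nothing is left of the diagonal sequence, in which \<open>s = r - 1\<close>.
\<close>

definition fdiff :: "(nat \<Rightarrow> 'a::comm_ring_1) \<Rightarrow> nat \<Rightarrow> 'a" where
  "fdiff p n = p (Suc n) - p n"

text \<open>Over the integers: \<open>p\<close> is a polynomial function of degree less than \<open>d\<close>.\<close>

definition fdiff_degree_less :: "nat \<Rightarrow> (nat \<Rightarrow> 'a::comm_ring_1) \<Rightarrow> bool" where
  "fdiff_degree_less d p \<longleftrightarrow> (fdiff ^^ d) p = (\<lambda>_. 0)"

lemma fdiff_degree_less_0 [simp]: "fdiff_degree_less 0 p \<longleftrightarrow> p = (\<lambda>_. 0)"
  by (simp add: fdiff_degree_less_def)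

lemma fdiff_degree_less_Suc [simp]:
  "fdiff_degree_less (Suc d) p \<longleftrightarrow> fdiff_degree_less d (fdiff p)"
  by (simp only: fdiff_degree_less_def funpow_Suc_right o_apply)

lemma fdiff_add: "fdiff (\<lambda>n. p n + q n) = (\<lambda>n. fdiff p n + fdiff q n)"
  by (simp add: fdiff_def fun_eq_iff)

lemma fdiff_uminus: "fdiff (\<lambda>n. - p n) = (\<lambda>n. - fdiff p n)"
  by (simp add: fdiff_def fun_eq_iff)

lemma fdiff_shift: "fdiff (\<lambda>n. p (Suc n)) = (\<lambda>n. fdiff p (Suc n))"
  by (simp add: fdiff_def fun_eq_iff)

lemma fdiff_degree_less_add:
  "fdiff_degree_less d p \<Longrightarrow> fdiff_degree_less d q \<Longrightarrow> fdiff_degree_less d (\<lambda>n. p n + q n)"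
  by (induction d arbitrary: p q) (auto simp: fdiff_add)

lemma fdiff_degree_less_uminus:
  "fdiff_degree_less d p \<Longrightarrow> fdiff_degree_less d (\<lambda>n. - p n)"
  by (induction d arbitrary: p) (auto simp: fdiff_uminus)

lemma fdiff_degree_less_shift:
  "fdiff_degree_less d p \<Longrightarrow> fdiff_degree_less d (\<lambda>n. p (Suc n))"
proof (induction d arbitrary: p)
  case 0
  then show ?case by simp
next
  case (Suc d)
  then show ?case
    using fdiff_shift [of p] by simp
qed

lemma fdiff_linear_mult:
  "fdiff (\<lambda>n. (of_nat n + c) * p n) = (\<lambda>n. (of_nat n + (c + 1)) * fdiff p n + p n)"
  by (simp add: fdiff_def fun_eq_iff algebra_simps)

text \<open>By the discrete product rule \<open>fdiff_linear_mult\<close>, differencing leaves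
  \<open>p\<close> plus a linear factor times \<open>fdiff p\<close>. Its constant has grown to
  \<open>c + 1\<close>, so the induction must keep \<open>c\<close> arbitrary.\<close>

lemma fdiff_degree_less_linear_mult:
  "fdiff_degree_less d p \<Longrightarrow> fdiff_degree_less (Suc d) (\<lambda>n. (of_nat n + c) * p n)"
proof (induction d arbitrary: p c)
  case 0
  then show ?case by (simp add: fdiff_def fun_eq_iff)
next
  case (Suc d)
  have "fdiff_degree_less (Suc d) (\<lambda>n. (of_nat n + (c + 1)) * fdiff p n)"
    using Suc.prems by (intro Suc.IH) simp
  from fdiff_degree_less_add [OF this Suc.prems] show ?case
    by (subst fdiff_degree_less_Suc) (simp only: fdiff_linear_mult)
qed

text \<open>This is the triangular recurrence for \<open>Stirling (Suc k + Suc s) (Suc k)\<close>: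
  its second summand is the value subtracted by \<open>fdiff\<close>.\<close>

lemma fdiff_Stirling:
  "fdiff (\<lambda>k. of_nat (Stirling (k + Suc s) k)) =
    (\<lambda>k. (of_nat k + 1) * of_nat (Stirling (Suc k + s) (Suc k)))"
  by (simp add: fdiff_def fun_eq_iff algebra_simps)

lemma fdiff_degree_less_Stirling:
  "fdiff_degree_less (2 * s + 1) (\<lambda>k. of_nat (Stirling (k + s) k))"
proof (induction s)
  case 0
  then show ?case by (simp add: fdiff_def fun_eq_iff)
next
  case (Suc s)
  have "fdiff_degree_less (Suc (2 * s + 1))
      (\<lambda>k. (of_nat k + 1 :: 'a) * of_nat (Stirling (Suc k + s) (Suc k)))"
    by (rule fdiff_degree_less_linear_mult, rule fdiff_degree_less_shift [OF Suc.IH])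
  then have "fdiff_degree_less (Suc (Suc (2 * s + 1)))
      (\<lambda>k. of_nat (Stirling (k + Suc s) k) :: 'a)"
    by (subst fdiff_degree_less_Suc) (simp only: fdiff_Stirling)
  then show ?case by (simp del: fdiff_degree_less_Suc)
qed

definition fib_op :: "(nat \<Rightarrow> 'a::comm_ring_1) \<Rightarrow> nat \<Rightarrow> 'a" where
  "fib_op a n = a (n + 2) - a (n + 1) - a n"

lemma fib_op_add: "fib_op (\<lambda>n. a n + b n) = (\<lambda>n. fib_op a n + fib_op b n)"
  by (simp add: fib_op_def fun_eq_iff)

lemma funpow_fib_op_add:
  "(fib_op ^^ d) (\<lambda>n. a n + b n) = (\<lambda>n. (fib_op ^^ d) a n + (fib_op ^^ d) b n)"
  by (induction d) (simp_all add: fib_op_add)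

text \<open>Substitute \<open>G n = G (n + 2) - G (n + 1)\<close>: the coefficients become
  \<open>p (n + 2) - p n\<close>, a sum of two consecutive differences, and
  \<open>- (p (n + 1) - p n)\<close>.\<close>

lemma fib_op_mult:
  assumes "\<And>n. G (n + 2) = G (n + 1) + G n"
  shows "fib_op (\<lambda>n. p n * G n) =
    (\<lambda>n. (fdiff p (Suc n) + fdiff p n) * G (n + 2) + (- fdiff p n) * G (n + 1))"
  using assms by (simp add: fib_op_def fdiff_def fun_eq_iff algebra_simps)

lemma funpow_fib_op_mult:
  assumes "fdiff_degree_less d p" and "\<And>n. G (n + 2) = G (n + 1) + G n"
  shows "(fib_op ^^ d) (\<lambda>n. p n * G n) = (\<lambda>_. 0)"
  using assms
\<comment> \<open>\<open>G\<close> varies because the induction hypothesis is applied to its shifts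
  by 2 and by 1.\<close>
proof (induction d arbitrary: p G)
  case 0
  then show ?case by simp
next
  case (Suc d)
  have p: "fdiff_degree_less d (fdiff p)"
    using Suc.prems(1) by simp
  have G: "G (n + k + 2) = G (n + k + 1) + G (n + k)" for n k
    by (rule Suc.prems(2))
  have "(fib_op ^^ d) (\<lambda>n. (fdiff p (Suc n) + fdiff p n) * G (n + 2)) = (\<lambda>_. 0)"
    using G [of _ 2] p
    by (intro Suc.IH fdiff_degree_less_add fdiff_degree_less_shift) (simp_all add: ac_simps)
  moreover have "(fib_op ^^ d) (\<lambda>n. (- fdiff p n) * G (n + 1)) = (\<lambda>_. 0)"
    using G [of _ 1] p
    by (intro Suc.IH fdiff_degree_less_uminus) (simp_all add: ac_simps)
  moreover have "(fib_op ^^ Suc d) (\<lambda>n. p n * G n) =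
      (fib_op ^^ d) (\<lambda>n. (fdiff p (Suc n) + fdiff p n) * G (n + 2) + (- fdiff p n) * G (n + 1))"
    by (simp only: funpow_Suc_right o_apply fib_op_mult [of G, OF Suc.prems(2)])
  ultimately show ?case
    by (simp only: funpow_fib_op_add) simp
qed

text \<open>This is the action of \<open>q\<close> on sequences in which the variable acts as the
  shift.\<close>

definition poly_shift :: "'a::comm_ring_1 poly \<Rightarrow> (nat \<Rightarrow> 'a) \<Rightarrow> nat \<Rightarrow> 'a" where
  "poly_shift q a n = (\<Sum>i\<le>degree q. coeff q i * a (n + i))"

text \<open>Padding with zero coefficients lets polynomials of different degrees share one summation
  range.\<close>

lemma poly_shift_eq_sum:
  assumes "degree q \<le> N"
  shows "poly_shift q a n = (\<Sum>i\<le>N. coeff q i * a (n + i))"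
  unfolding poly_shift_def using assms
  by (intro sum.mono_neutral_left) (auto simp: coeff_eq_0)

lemma poly_shift_add: "poly_shift (p + q) a n = poly_shift p a n + poly_shift q a n"
proof -
  define N where "N = max (degree p) (degree q)"
  have "degree (p + q) \<le> N" "degree p \<le> N" "degree q \<le> N"
    by (auto simp: N_def degree_add_le_max)
  then show ?thesis
    by (simp add: poly_shift_eq_sum [where N = N] sum.distrib algebra_simps)
qed

lemma poly_shift_uminus: "poly_shift (- p) a n = - poly_shift p a n"
  by (simp add: poly_shift_def sum_negf)

lemma poly_shift_pCons_0: "poly_shift (pCons 0 q) a n = poly_shift q a (Suc n)"
  by (simp add: poly_shift_eq_sum [OF degree_pCons_le] sum.atMost_Suc_shift
      poly_shift_eq_sum [OF order_refl] del: sum.atMost_Suc)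

lemma poly_shift_fib_mult: "poly_shift ([:-1, -1, 1:] * q) a = poly_shift q (fib_op a)"
proof
  fix n
  have "[:-1, -1, 1:] * q = pCons 0 (pCons 0 q) + - pCons 0 q + - q"
    by simp
  then have "poly_shift ([:-1, -1, 1:] * q) a n =
      poly_shift q a (n + 2) - poly_shift q a (n + 1) - poly_shift q a n"
    by (simp only: poly_shift_add poly_shift_uminus poly_shift_pCons_0) simp
  also have "\<dots> = poly_shift q (fib_op a) n"
    by (simp add: poly_shift_def fib_op_def sum_subtractf sum.distrib algebra_simps)
  finally show "poly_shift ([:-1, -1, 1:] * q) a n = poly_shift q (fib_op a) n" .
qed

lemma poly_shift_fib_power: "poly_shift ([:-1, -1, 1:] ^ d) a = (fib_op ^^ d) a"
proof (induction d arbitrary: a)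
  case 0
  then show ?case by (simp add: poly_shift_def fun_eq_iff)
next
  case (Suc d)
  then show ?case
    by (simp only: power_Suc poly_shift_fib_mult funpow_Suc_right o_apply)
qed

text \<open>Reverse the summation by \<open>i = degree q - j\<close>; the assumption keeps
  \<open>n - j\<close> from truncating.\<close>

lemma sum_coeff_rev_eq_poly_shift:
  assumes "degree q \<le> n"
  shows "(\<Sum>j=0..degree q. coeff q (degree q - j) * a (n - j)) = poly_shift q a (n - degree q)"
  unfolding poly_shift_def using assms
  by (intro sum.reindex_bij_witness [where i = "\<lambda>i. degree q - i" and j = "\<lambda>j. degree q - j"])
    auto

lemma poly_shift_offset: "poly_shift q (\<lambda>m. a (k + m)) n = poly_shift q a (k + n)"
  by (simp add: poly_shift_def add.assoc)

lemma poly_shift_diag_seq: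
  assumes "r \<ge> 1"
  shows "poly_shift (diag_poly r) (\<lambda>n. int (diag_seq r n)) (r + m) = 0"
proof -
  define p where "p = (\<lambda>k. int (Stirling (k + (r - 1)) k))"
  have "fdiff_degree_less (2 * (r - 1) + 1) p"
    using fdiff_degree_less_Stirling [of "r - 1", where 'a = int] by (simp only: p_def of_nat_id)
  also have "2 * (r - 1) + 1 = 2 * r - 1"
    using assms by simp
  finally have p: "fdiff_degree_less (2 * r - 1) (\<lambda>m. p (Suc m))"
    by (rule fdiff_degree_less_shift)
  \<comment> \<open>At \<open>n = r + m\<close> the lower Stirling index is
    \<open>n - r + 1 = m + 1\<close>, hence the shifted \<open>p\<close> and the Fibonacci index
    \<open>m + 2\<close>.\<close>
  have "int (diag_seq r (r + m)) = p (Suc m) * int (fib (m + 2))" for m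
    using assms by (simp add: diag_seq_def fib_fubini_def p_def ac_simps)
  then have "poly_shift (diag_poly r) (\<lambda>n. int (diag_seq r n)) (r + m) =
      poly_shift (diag_poly r) (\<lambda>m. p (Suc m) * int (fib (m + 2))) m"
    by (subst poly_shift_offset [symmetric]) (simp only:)
  also have "\<dots> = (fib_op ^^ (2 * r - 1)) (\<lambda>m. p (Suc m) * int (fib (m + 2))) m"
    by (simp only: diag_poly_def poly_shift_fib_power)
  also have "\<dots> = 0"
    using p by (subst funpow_fib_op_mult) (simp_all add: numeral_eq_Suc)
  finally show ?thesis .
qed

lemma degree_diag_poly: "degree (diag_poly r) = 4 * r - 2"
  by (simp add: diag_poly_def degree_power_eq)

theorem theorem11:
  fixes r :: nat
  assumes "r \<ge> 1"
  shows "degree (diag_poly r) = 4 * r - 2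
    \<and> is_char_poly_from r (\<lambda>n. int (diag_seq r n)) (diag_poly r)
    \<and> (\<forall>n \<ge> r + (4 * r - 2).
         (\<Sum>j=0..4 * r - 2. coeff (diag_poly r) (4 * r - 2 - j) * int (diag_seq r (n - j))) = 0)"
proof -
  have recurrence: "(\<Sum>j=0..degree (diag_poly r).
      coeff (diag_poly r) (degree (diag_poly r) - j) * int (diag_seq r (n - j))) = 0"
    if "n \<ge> r + degree (diag_poly r)" for n
  proof -
    \<comment> \<open>The smallest index in the sum is \<open>r + m\<close>, so only meaningful
      values of the diagonal occur.\<close>
    define m where "m = n - degree (diag_poly r) - r"
    have n: "degree (diag_poly r) \<le> n" "n - degree (diag_poly r) = r + m"
      using that by (simp_all add: m_def)
    show ?thesis
      using sum_coeff_rev_eq_poly_shift [of "diag_poly r" n "\<lambda>n. int (diag_seq r n)", OF n(1)]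
        poly_shift_diag_seq [OF assms, of m]
      by (simp only: n(2))
  qed
  moreover have "lead_coeff (diag_poly r) = 1"
    by (simp only: diag_poly_def lead_coeff_power) simp
  ultimately have "is_char_poly_from r (\<lambda>n. int (diag_seq r n)) (diag_poly r)"
    unfolding is_char_poly_from_def by blast
  with recurrence degree_diag_poly [of r] show ?thesis
    by simp
qed

end
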